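(* The sequences $$\left\{\sqrt[n]{\tfrac{1}{n+1}\tbinom{2n}{n}}\right\}_{n\geq 1},\ \left\{\sqrt[n]{\tbinom{2n}{n}}\right\}_{n\geq 1},\ \left\{\sqrt[n]{\tbinom{3n}{n}}\right\}_{n\geq 1},\ \left\{\sqrt[n]{\tbinom{4n}{n}}\right\}_{n\geq 1},\ \left\{\sqrt[n]{\tbinom{5n}{n}}\right\}_{n\geq 1},\ \left\{\sqrt[n]{\tbinom{5n}{2n}}\right\}_{n\geq 1}$$ are strictly log-concave, and for every integer $p\geq 2$ the sequence $\left\{\sqrt[n]{C_p(n)}\right\}_{n\geq 2}$ is strictly log-concave.
   Context: For an integer $p\geq 2$, the Fuss-Catalan numbers are $C_p(n)=\frac{1}{(p-1)n+1}\binom{pn}{n}$. A sequence of positive numbers $\{z_n\}_{n\geq m}$ is strictly log-concave if $z_{n-1}z_{n+1}<z_n^2$ for all $n\geq m+1$. *)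

theory Defs
  imports Complex_Main
begin

text \<open>
  A sequence \<open>{z\<^sub>n}\<close> indexed by \<open>n \<ge> m\<close> is represented by a total function on the naturals, of
  which only the values at indices \<open>n \<ge> m\<close> matter.  Positivity of the terms is part of the notion.
\<close>

definition strictly_log_concave_from :: "nat \<Rightarrow> (nat \<Rightarrow> real) \<Rightarrow> bool" where
  "strictly_log_concave_from m z \<longleftrightarrow>
     (\<forall>n\<ge>m. 0 < z n) \<and> (\<forall>n\<ge>m + 1. z (n - 1) * z (n + 1) < (z n)\<^sup>2)"

definition fuss_catalan :: "nat \<Rightarrow> nat \<Rightarrow> real" where
  "fuss_catalan p n = 1 / ((real p - 1) * real n + 1) * real ((p * n) choose n)"

end

theory Submission
  imports Defs
begin

text \<open>
  Write \<open>L = ln \<circ> a\<close>.  Strict log-concavity of \<open>root n (a n)\<close> at \<open>n = k + 1\<close> says that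
  \<open>D k = (k + 1) (k + 2) L k + k (k + 1) L (k + 2) - 2 k (k + 2) L (k + 1)\<close> is negative, and
  \<open>D (k + 1) - D k\<close> is \<open>(k + 1) (k + 2)\<close> times the third difference of \<open>L\<close> at \<open>k\<close>.  So it suffices
  to have \<open>D\<close> negative at the first index and the ratios \<open>a (k + 1) / a k\<close> strictly log-concave.  For
  all sequences at hand the ratio is \<open>c \<Prod> (k + \<alpha> i) / (k + \<beta> i)\<close> with \<open>\<alpha> i < \<beta> i\<close>, and each
  factor is strictly log-concave because \<open>(x - 1) (x + 1) / x\<^sup>2 = 1 - 1 / x\<^sup>2\<close> increases with \<open>x\<close>.
\<close>

section \<open>Strict log-concavity of roots from third differences of logarithms\<close>

lemma third_difference_neg_imp:
  fixes L :: "nat \<Rightarrow> real"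
  defines "D \<equiv> \<lambda>k::nat. (real k + 1) * (real k + 2) * L k + real k * (real k + 1) * L (k + 2)
              - 2 * real k * (real k + 2) * L (k + 1)"
  assumes third: "\<And>k. k \<ge> m \<Longrightarrow> L (k + 3) - 3 * L (k + 2) + 3 * L (k + 1) - L k < 0"
    and base: "D m < 0"
    and "k \<ge> m"
  shows "D k < 0"
  using \<open>k \<ge> m\<close>
proof (induction k rule: dec_induct)
  case base
  show ?case by (fact assms(3))
next
  case (step k)
  have "D (Suc k) - D k = (real k + 1) * (real k + 2) * (L (k + 3) - 3 * L (k + 2) + 3 * L (k + 1) - L k)"
    by (simp add: D_def algebra_simps eval_nat_numeral)
  also have "\<dots> < 0"
    using third[OF step.hyps(1)] by (intro mult_pos_neg) auto
  finally show ?case using step.IH by simp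
qed

text \<open>The hypotheses \<open>third\<close> and \<open>base\<close> are the exponentiated forms
  of a negative third difference of \<open>ln (a k)\<close> and of \<open>D m < 0\<close>. Without
  logarithms they can be checked by plain arithmetic.\<close>

lemma strictly_log_concave_from_rootI:
  fixes a :: "nat \<Rightarrow> real"
  assumes "m \<ge> 1" and pos: "\<And>n. n \<ge> m \<Longrightarrow> 0 < a n"
    and third: "\<And>k. k \<ge> m \<Longrightarrow> a (k + 3) * a (k + 1) ^ 3 < a (k + 2) ^ 3 * a k"
    and base: "a m ^ ((m + 1) * (m + 2)) * a (m + 2) ^ (m * (m + 1)) < a (m + 1) ^ (2 * m * (m + 2))"
  shows "strictly_log_concave_from m (\<lambda>n. root n (a n))"
proof -
  define L where "L n = ln (a n)" for n
  have L3: "L (k + 3) - 3 * L (k + 2) + 3 * L (k + 1) - L k < 0" if "k \<ge> m" for k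
  proof -
    have "ln (a (k + 3) * a (k + 1) ^ 3) < ln (a (k + 2) ^ 3 * a k)"
      using third[OF that] pos that by (subst ln_less_cancel_iff) auto
    then show ?thesis
      using pos[of k] pos[of "k+1"] pos[of "k+2"] pos[of "k+3"] that
      by (simp add: L_def ln_mult ln_realpow)
  qed
  have "ln (a m ^ ((m + 1) * (m + 2)) * a (m + 2) ^ (m * (m + 1))) < ln (a (m + 1) ^ (2 * m * (m + 2)))"
    using base pos by (subst ln_less_cancel_iff) auto
  then have D0: "(real m + 1) * (real m + 2) * L m + real m * (real m + 1) * L (m + 2)
              - 2 * real m * (real m + 2) * L (m + 1) < 0"
    using pos[of m] pos[of "m+1"] pos[of "m+2"]
    by (simp add: L_def ln_mult ln_realpow algebra_simps)
  have "root (n - 1) (a (n - 1)) * root (n + 1) (a (n + 1)) < (root n (a n))\<^sup>2" if "n \<ge> m + 1" for n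
  proof -
    define k where "k = n - 1"
    have n: "n = k + 1" and km: "k \<ge> m" and k: "k \<ge> 1"
      using that \<open>m \<ge> 1\<close> by (auto simp: k_def)
    have p: "0 < a k" "0 < a (k + 1)" "0 < a (k + 2)" using pos km by auto
    have D: "(real k + 1) * (real k + 2) * L k + real k * (real k + 1) * L (k + 2)
              - 2 * real k * (real k + 2) * L (k + 1) < 0" (is "?D < 0")
      by (rule third_difference_neg_imp[OF L3 D0 km])
    \<comment> \<open>Division by \<open>k (k + 1) (k + 2)\<close> turns \<open>?D\<close> into the
      second difference of \<open>L n / n\<close>, which is the logarithm of the \<open>n\<close>-th
      root.\<close>
    have "L k / k + L (k + 2) / (k + 2) - 2 * (L (k + 1) / (k + 1)) = ?D / (real k * (real k + 1) * (real k + 2))"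
      using k by (simp add: divide_simps) (simp add: algebra_simps)
    also have "\<dots> < 0"
      using D k by (intro divide_neg_pos) auto
    finally have less: "L k / k + L (k + 2) / (k + 2) < 2 * (L (k + 1) / (k + 1))" by simp
    have "ln (root k (a k) * root (k + 2) (a (k + 2))) = L k / k + L (k + 2) / (k + 2)"
      using p k by (simp add: ln_mult ln_root L_def)
    moreover have "ln ((root (k + 1) (a (k + 1)))\<^sup>2) = 2 * (L (k + 1) / (k + 1))"
      using p by (simp add: ln_realpow ln_root L_def)
    ultimately have "ln (root k (a k) * root (k + 2) (a (k + 2))) < ln ((root (k + 1) (a (k + 1)))\<^sup>2)"
      using less by simp
    then have "root k (a k) * root (k + 2) (a (k + 2)) < (root (k + 1) (a (k + 1)))\<^sup>2"
      using p k by (subst (asm) ln_less_cancel_iff) auto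
    then show ?thesis by (simp add: n)
  qed
  moreover have "0 < root n (a n)" if "n \<ge> m" for n
    using pos[OF that] that \<open>m \<ge> 1\<close> by simp
  ultimately show ?thesis
    unfolding strictly_log_concave_from_def by blast
qed

section \<open>Sequences whose ratio is a product of shifted linear fractions\<close>

lemma shifted_ratio_strictly_log_concave:
  fixes x \<alpha> \<beta> :: real
  assumes "0 < x" "0 \<le> \<alpha>" "\<alpha> < \<beta>"
  shows "((x + \<alpha>) / (x + \<beta>)) * ((x + 2 + \<alpha>) / (x + 2 + \<beta>)) < ((x + 1 + \<alpha>) / (x + 1 + \<beta>))\<^sup>2"
proof -
  \<comment> \<open>Centred at the middle index, the two outer numerators multiply to
    \<open>y\<^sup>2 - 1\<close> and the two outer denominators to
    \<open>z\<^sup>2 - 1\<close>.\<close>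
  define y z where "y = x + 1 + \<alpha>" and "z = x + 1 + \<beta>"
  have yz: "1 < y" "y < z" using assms by (auto simp: y_def z_def)
  have sq: "y\<^sup>2 < z\<^sup>2" using yz by (intro power_strict_mono) auto
  have "(y\<^sup>2 - 1) * z\<^sup>2 < (z\<^sup>2 - 1) * y\<^sup>2"
    using sq by (simp add: algebra_simps)
  moreover have "0 < z\<^sup>2 - 1" "0 < z\<^sup>2"
    using yz by (auto simp: power2_eq_square) (meson less_1_mult less_trans)
  ultimately have "(y\<^sup>2 - 1) / (z\<^sup>2 - 1) < y\<^sup>2 / z\<^sup>2"
    by (simp add: divide_simps mult.commute)
  moreover have "(x + \<alpha>) * (x + 2 + \<alpha>) = y\<^sup>2 - 1" "(x + \<beta>) * (x + 2 + \<beta>) = z\<^sup>2 - 1"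
    by (simp_all add: y_def z_def power2_eq_square algebra_simps)
  ultimately show ?thesis
    by (simp add: power_divide y_def z_def)
qed

lemma strictly_log_concave_from_root_ratioI:
  fixes a :: "nat \<Rightarrow> real" and \<alpha> \<beta> :: "'i \<Rightarrow> real"
  assumes "m \<ge> 1" and pos: "\<And>n. 0 < a n"
    and ratio: "\<And>n. a (Suc n) = a n * (c * (\<Prod>i\<in>I. (real n + \<alpha> i) / (real n + \<beta> i)))"
    and I: "finite I" "I \<noteq> {}" "\<And>i. i \<in> I \<Longrightarrow> 0 \<le> \<alpha> i \<and> \<alpha> i < \<beta> i"
    and base: "a m ^ ((m + 1) * (m + 2)) * a (m + 2) ^ (m * (m + 1)) < a (m + 1) ^ (2 * m * (m + 2))"
  shows "strictly_log_concave_from m (\<lambda>n. root n (a n))"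
proof (rule strictly_log_concave_from_rootI[OF \<open>m \<ge> 1\<close> pos _ base])
  fix k assume "k \<ge> m"
  define P where "P n = (\<Prod>i\<in>I. (real n + \<alpha> i) / (real n + \<beta> i))" for n
  define r where "r n = c * P n" for n
  have r: "a (Suc n) = a n * r n" for n using ratio by (simp add: r_def P_def)
  then have rpos: "0 < r n" for n by (metis pos zero_less_mult_pos)
  have "P k * P (k + 2) = (\<Prod>i\<in>I. ((real k + \<alpha> i) / (real k + \<beta> i)) * ((real k + 2 + \<alpha> i) / (real k + 2 + \<beta> i)))"
    by (simp add: P_def prod.distrib algebra_simps del: times_divide_eq_left times_divide_eq_right)
  also have "(\<Prod>i\<in>I. ((real k + \<alpha> i) / (real k + \<beta> i)) * ((real k + 2 + \<alpha> i) / (real k + 2 + \<beta> i)))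
      < (\<Prod>i\<in>I. ((real k + 1 + \<alpha> i) / (real k + 1 + \<beta> i))\<^sup>2)"
    (is "prod ?f I < prod ?g I")
  proof -
    have k: "0 < real k" using \<open>k \<ge> m\<close> \<open>m \<ge> 1\<close> by simp
    have fg: "0 \<le> ?f i \<and> ?f i < ?g i \<and> 0 < ?g i" if i: "i \<in> I" for i
    proof -
      have "0 \<le> \<alpha> i" "\<alpha> i < \<beta> i" using I(3)[OF i] by auto
      with shifted_ratio_strictly_log_concave[OF k this] k show ?thesis by simp
    qed
    from I(2) obtain i where "i \<in> I" by blast
    with fg I(1) show ?thesis
      by (intro prod_mono_strict[of i]) (auto intro: less_imp_le)
  qed
  also have "\<dots> = (P (k + 1))\<^sup>2"
    by (simp add: P_def prod_power_distrib algebra_simps)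
  finally have P: "P k * P (k + 2) < (P (k + 1))\<^sup>2" .
  \<comment> \<open>The constant enters both sides only through its square, so its sign is
    irrelevant.\<close>
  have "c \<noteq> 0" using rpos[of 0] by (auto simp: r_def)
  then have "c\<^sup>2 * (P k * P (k + 2)) < c\<^sup>2 * (P (k + 1))\<^sup>2"
    using P by (intro mult_strict_left_mono) auto
  then have "r k * r (k + 2) < (r (k + 1))\<^sup>2"
    by (simp add: r_def power2_eq_square mult_ac)
  \<comment> \<open>This prefactor is what \<open>a (k + 3) * a (k + 1) ^ 3\<close> and
    \<open>a (k + 2) ^ 3 * a k\<close> have in common once every term is expressed by
    \<open>a k\<close> and the ratios.\<close>
  then have "(a k ^ 4 * r k ^ 3 * r (k + 1)) * (r k * r (k + 2)) < (a k ^ 4 * r k ^ 3 * r (k + 1)) * (r (k + 1))\<^sup>2"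
    using rpos pos by (intro mult_strict_left_mono mult_pos_pos zero_less_power)
  moreover have "a (k + 1) = a k * r k" "a (k + 2) = a k * r k * r (k + 1)"
    "a (k + 3) = a k * r k * r (k + 1) * r (k + 2)"
    using r[of k] r[of "k+1"] r[of "k+2"] by (simp_all add: eval_nat_numeral)
  ultimately show "a (k + 3) * a (k + 1) ^ 3 < a (k + 2) ^ 3 * a k"
    by (simp add: eval_nat_numeral mult_ac)
qed

section \<open>Factorial recurrences and the shifted Fuss sequences\<close>

lemma fact_mult_Suc_add:
  assumes "q > 0"
  shows "(fact (q * Suc n + j) :: real) =
    fact (q * n + j) * (real q ^ q * (\<Prod>i=1..q. real n + real (i + j) / real q))"
proof -
  have "(fact (N + k) :: real) = fact N * (\<Prod>i=1..k. real (N + i))" for N k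
    by (induction k) (simp_all add: algebra_simps)
  from this[of "q * n + j" q]
  have "(fact (q * Suc n + j) :: real) = fact (q * n + j) * (\<Prod>i=1..q. real (q * n + j + i))"
    by (simp add: add_ac)
  \<comment> \<open>Pulling \<open>q\<close> out of each new factor makes it monic in
    \<open>n\<close>, which exposes the shifts \<alpha> and \<beta>.\<close>
  also have "(\<Prod>i=1..q. real (q * n + j + i)) = (\<Prod>i=1..q. real q * (real n + real (i + j) / real q))"
    using assms by (intro prod.cong) (simp_all add: field_simps)
  also have "\<dots> = real q ^ q * (\<Prod>i=1..q. real n + real (i + j) / real q)"
    by (simp only: prod.distrib prod_constant card_atLeastAtMost) simp
  finally show ?thesis .
qed

text \<open>
  The shift \<open>j = 0\<close> gives \<open>(q + 1) n\<close> choose \<open>n\<close>, and \<open>j = 1\<close> gives the Fuss-Catalan number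
  \<open>C\<^sub>p(n)\<close> for \<open>p = q + 1\<close>.
\<close>

definition shifted_fuss :: "nat \<Rightarrow> nat \<Rightarrow> nat \<Rightarrow> real" where
  "shifted_fuss q j n = fact (Suc q * n) / (fact n * fact (q * n + j))"

lemma shifted_fuss_0: "shifted_fuss q 0 n = real ((Suc q * n) choose n)"
  by (simp add: shifted_fuss_def binomial_fact)

lemma shifted_fuss_1: "shifted_fuss q 1 n = fuss_catalan (Suc q) n"
  by (simp add: shifted_fuss_def fuss_catalan_def binomial_fact algebra_simps)

text \<open>Of the \<open>Suc q\<close> monic factors in the numerator, the last is
  \<open>n + 1\<close> and cancels against the growth of \<open>fact n\<close>. This leaves
  \<open>q\<close> factors on each side, paired by index.\<close>

lemma shifted_fuss_Suc:
  assumes "q > 0"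
  shows "shifted_fuss q j (Suc n) = shifted_fuss q j n * ((real (Suc q) ^ Suc q / real q ^ q) *
    (\<Prod>i=1..q. (real n + real i / real (Suc q)) / (real n + real (i + j) / real q)))"
proof -
  have cancel: "(F * (c * (A * s))) / ((s * N) * (G * (d * B))) = F / (N * G) * ((c / d) * (A / B))"
    if "s \<noteq> 0" for F c A s N G d B :: real
    using that by (simp add: mult_ac)
  have "(\<Prod>i=1..Suc q. real n + real i / real (Suc q))
      = (\<Prod>i=1..q. real n + real i / real (Suc q)) * real (Suc n)"
    by simp
  with fact_mult_Suc_add[of "Suc q" n 0]
  have "(fact (Suc q * Suc n) :: real) = fact (Suc q * n) * (real (Suc q) ^ Suc q *
      ((\<Prod>i=1..q. real n + real i / real (Suc q)) * real (Suc n)))"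
    by (simp only: add_0_right zero_less_Suc)
  then have "shifted_fuss q j (Suc n) =
     (fact (Suc q * n) * (real (Suc q) ^ Suc q * ((\<Prod>i=1..q. real n + real i / real (Suc q)) * real (Suc n))))
     / ((real (Suc n) * fact n) * (fact (q * n + j) * (real q ^ q * (\<Prod>i=1..q. real n + real (i + j) / real q))))"
    unfolding shifted_fuss_def fact_mult_Suc_add[OF assms] by (simp only: fact_Suc)
  also have "\<dots> = shifted_fuss q j n * ((real (Suc q) ^ Suc q / real q ^ q) *
    ((\<Prod>i=1..q. real n + real i / real (Suc q)) / (\<Prod>i=1..q. real n + real (i + j) / real q)))"
    unfolding shifted_fuss_def by (rule cancel) simp
  finally show ?thesis by (simp only: prod_dividef)
qed

lemma strictly_log_concave_from_root_shifted_fuss: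
  fixes q j :: nat
  defines "a \<equiv> shifted_fuss q j"
  assumes "q \<ge> 1" "m \<ge> 1"
    and "a m ^ ((m + 1) * (m + 2)) * a (m + 2) ^ (m * (m + 1)) < a (m + 1) ^ (2 * m * (m + 2))"
  shows "strictly_log_concave_from m (\<lambda>n. root n (a n))"
proof (rule strictly_log_concave_from_root_ratioI)
  show "a (Suc n) = a n * ((real (Suc q) ^ Suc q / real q ^ q) *
    (\<Prod>i\<in>{1..q}. (real n + real i / real (Suc q)) / (real n + real (i + j) / real q)))" for n
    unfolding a_def using \<open>q \<ge> 1\<close> by (intro shifted_fuss_Suc) simp
  \<comment> \<open>Since \<open>i\<close> is positive, \<open>i / (q + 1) < i / q\<close>, and the
    shift \<open>j\<close> can only enlarge the right-hand side.\<close>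
  show "0 \<le> real i / real (Suc q) \<and> real i / real (Suc q) < real (i + j) / real q" if "i \<in> {1..q}" for i
    using that by (simp add: divide_simps) (simp add: algebra_simps add_pos_nonneg)
qed (use assms in \<open>auto simp: shifted_fuss_def\<close>)

section \<open>The individual sequences\<close>

lemma strictly_log_concave_from_root_binomial_5_2:
  "strictly_log_concave_from 1 (\<lambda>n. root n (real ((5 * n) choose (2 * n))))"
proof -
  define a :: "nat \<Rightarrow> real" where "a n = fact (5 * n) / (fact (2 * n) * fact (3 * n))" for n
  \<comment> \<open>The factorials of \<open>2 * n\<close> and \<open>3 * n\<close> contribute the
    shifts 1/2, 1 and 1/3, 2/3, 1. One shift 1 cancels the numerator factor with
    \<open>i = 5\<close>. The others are sorted so that each exceeds its partner
    \<open>i / 5\<close>.\<close>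
  define \<beta> :: "nat \<Rightarrow> real"
    where "\<beta> i = (if i = 1 then 1/3 else if i = 2 then 1/2 else if i = 3 then 2/3 else 1)" for i
  have eq: "real ((5 * n) choose (2 * n)) = a n" for n
    by (simp add: a_def binomial_fact)
  have "strictly_log_concave_from 1 (\<lambda>n. root n (a n))"
  proof (rule strictly_log_concave_from_root_ratioI)
    fix n
    have "a (Suc n) = (fact (5 * n) * (5 ^ 5 * (\<Prod>i=1..5. real n + real i / 5))) /
      ((fact (2 * n) * (2 ^ 2 * (\<Prod>i=1..2. real n + real i / 2))) *
       (fact (3 * n) * (3 ^ 3 * (\<Prod>i=1..3. real n + real i / 3))))"
      using fact_mult_Suc_add[of 5 n 0] fact_mult_Suc_add[of 2 n 0] fact_mult_Suc_add[of 3 n 0]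
      by (simp only: a_def add_0_right of_nat_numeral zero_less_numeral simp_thms)
    also have "\<dots> = a n * ((5 ^ 5 / (2 ^ 2 * 3 ^ 3)) *
        (\<Prod>i\<in>{1..4}. (real n + real i / 5) / (real n + \<beta> i)))"
      by (simp add: a_def eval_nat_numeral atLeastAtMostSuc_conv \<beta>_def)
    finally show "a (Suc n) = a n * ((5 ^ 5 / (2 ^ 2 * 3 ^ 3)) *
        (\<Prod>i\<in>{1..4}. (real n + real i / 5) / (real n + \<beta> i)))" .
  next
    fix i :: nat assume "i \<in> {1..4}"
    then have "i = 1 \<or> i = 2 \<or> i = 3 \<or> i = 4" by auto
    then show "0 \<le> real i / 5 \<and> real i / 5 < \<beta> i" by (auto simp: \<beta>_def)
  next
    have "a 1 = 10" "a 2 = 210" "a 3 = 5005"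
      by (simp_all add: a_def fact_numeral)
    then show "a 1 ^ ((1 + 1) * (1 + 2)) * a (1 + 2) ^ (1 * (1 + 1)) < a (1 + 1) ^ (2 * 1 * (1 + 2))"
      by (simp flip: numeral_2_eq_2 numeral_3_eq_3)
  qed (auto simp: a_def)
  then show ?thesis by (simp add: eq)
qed

lemma strictly_log_concave_from_root_fuss_catalan:
  assumes "p \<ge> 2"
  shows "strictly_log_concave_from 2 (\<lambda>n. root n (fuss_catalan p n))"
proof -
  obtain q where p: "p = Suc q" and q: "q \<ge> 1" using assms by (cases p) auto
  define P where "P = real p"
  have P2: "P \<ge> 2" using assms by (simp add: P_def)
  have a2: "fuss_catalan p 2 = P"
    using assms P2
    by (simp add: fuss_catalan_def binomial_altdef_of_nat P_def eval_nat_numeral of_nat_diff divide_simps)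
  have a3: "fuss_catalan p 3 = P * (3 * P - 1) / 2"
    using assms P2
    by (simp add: fuss_catalan_def binomial_altdef_of_nat P_def eval_nat_numeral of_nat_diff divide_simps)
  have a4: "fuss_catalan p 4 = P * ((4 * P - 1) * (2 * P - 1)) / 3"
    using assms P2
    by (simp add: fuss_catalan_def binomial_altdef_of_nat P_def eval_nat_numeral of_nat_diff divide_simps)
      (simp add: algebra_simps)
  \<comment> \<open>The base inequality at \<open>m = 2\<close> has exponents 12, 6 and 16, all
    even, so its square root with exponents 6, 3 and 8 is proved first. After cancelling
    \<open>P ^ 8\<close> and clearing the denominators \<open>2 ^ 8 = 256\<close> and
    \<open>3 ^ 3 = 27\<close>, it reads
    \<open>256 * P * ((4 * P - 1) * (2 * P - 1)) ^ 3 < 27 * s ^ 8\<close>.\<close>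
  define s where "s = 3 * P - 1"
  have s5: "s \<ge> 5" using P2 by (simp add: s_def)
  \<comment> \<open>The two sides differ by \<open>P\<^sup>2\<close>. This bound reduces the goal to
    the quadratic estimate \<open>256 * P < 27 * s\<^sup>2\<close>.\<close>
  have "(4 * P - 1) * (2 * P - 1) \<le> s\<^sup>2"
    by (simp add: s_def power2_eq_square algebra_simps)
  moreover have "0 \<le> (4 * P - 1) * (2 * P - 1)" using P2 by simp
  ultimately have "((4 * P - 1) * (2 * P - 1)) ^ 3 \<le> (s\<^sup>2) ^ 3"
    by (intro power_mono)
  then have "256 * P * ((4 * P - 1) * (2 * P - 1)) ^ 3 \<le> 256 * P * s ^ 6"
    using P2 by (intro mult_left_mono) auto
  also have "\<dots> < 27 * s\<^sup>2 * s ^ 6"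
  proof (rule mult_strict_right_mono)
    have "27 * (5 * s) \<le> 27 * s\<^sup>2" using s5 by (simp add: power2_eq_square)
    then show "256 * P < 27 * s\<^sup>2" using P2 by (simp add: s_def)
  qed (use s5 in simp)
  finally have "256 * P * ((4 * P - 1) * (2 * P - 1)) ^ 3 < 27 * s ^ 8"
    by (simp add: eval_nat_numeral mult_ac)
  then have "P ^ 8 * (256 * P * ((4 * P - 1) * (2 * P - 1)) ^ 3) < P ^ 8 * (27 * s ^ 8)"
    using P2 by (intro mult_strict_left_mono) auto
  then have "fuss_catalan p 2 ^ 6 * fuss_catalan p 4 ^ 3 < fuss_catalan p 3 ^ 8"
    unfolding a2 a3 a4 s_def[symmetric]
    by (simp add: power_divide power_mult_distrib eval_nat_numeral mult_ac)
  then have "(fuss_catalan p 2 ^ 6 * fuss_catalan p 4 ^ 3)\<^sup>2 < (fuss_catalan p 3 ^ 8)\<^sup>2"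
    using P2 by (intro power_strict_mono) (simp_all add: a2 a4)
  then have "fuss_catalan p 2 ^ 12 * fuss_catalan p 4 ^ 6 < fuss_catalan p 3 ^ 16"
    by (simp add: power_mult_distrib flip: power_mult)
  with strictly_log_concave_from_root_shifted_fuss[of q 2 1] q show ?thesis
    unfolding shifted_fuss_1 p by simp
qed

theorem corollary3p8:
  shows "strictly_log_concave_from 1 (\<lambda>n. root n (1 / (real n + 1) * real ((2 * n) choose n)))
    \<and> strictly_log_concave_from 1 (\<lambda>n. root n (real ((2 * n) choose n)))
    \<and> strictly_log_concave_from 1 (\<lambda>n. root n (real ((3 * n) choose n)))
    \<and> strictly_log_concave_from 1 (\<lambda>n. root n (real ((4 * n) choose n)))
    \<and> strictly_log_concave_from 1 (\<lambda>n. root n (real ((5 * n) choose n)))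
    \<and> strictly_log_concave_from 1 (\<lambda>n. root n (real ((5 * n) choose (2 * n))))
    \<and> (\<forall>p\<ge>2. strictly_log_concave_from 2 (\<lambda>n. root n (fuss_catalan p n)))"
proof -
  \<comment> \<open>At \<open>m = 1\<close> the base inequality has exponents 6, 2 and 6, so each
    sequence below needs only a numerical comparison of its first three terms.\<close>
  have base: "strictly_log_concave_from 1 (\<lambda>n. root n (shifted_fuss q j n))"
    if "q \<ge> 1" "shifted_fuss q j 1 ^ 6 * shifted_fuss q j 3 ^ 2 < shifted_fuss q j 2 ^ 6" for q j
    using strictly_log_concave_from_root_shifted_fuss[of q 1 j] that
    by (simp flip: numeral_2_eq_2 numeral_3_eq_3)
  have "strictly_log_concave_from 1 (\<lambda>n. root n (shifted_fuss 1 1 n))"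
    by (rule base) (simp_all add: shifted_fuss_def fact_numeral)
  then have "strictly_log_concave_from 1 (\<lambda>n. root n (1 / (real n + 1) * real ((2 * n) choose n)))"
    by (simp add: shifted_fuss_1 fuss_catalan_def flip: numeral_2_eq_2 del: One_nat_def)
  moreover have "strictly_log_concave_from 1 (\<lambda>n. root n (shifted_fuss 1 0 n))"
    by (rule base) (simp_all add: shifted_fuss_def fact_numeral)
  then have "strictly_log_concave_from 1 (\<lambda>n. root n (real ((2 * n) choose n)))"
    by (simp add: shifted_fuss_0 flip: numeral_2_eq_2)
  moreover have "strictly_log_concave_from 1 (\<lambda>n. root n (shifted_fuss 2 0 n))"
    by (rule base) (simp_all add: shifted_fuss_def fact_numeral)
  then have "strictly_log_concave_from 1 (\<lambda>n. root n (real ((3 * n) choose n)))"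
    by (simp add: shifted_fuss_0 flip: numeral_2_eq_2)
  moreover have "strictly_log_concave_from 1 (\<lambda>n. root n (shifted_fuss 3 0 n))"
    by (rule base) (simp_all add: shifted_fuss_def fact_numeral)
  then have "strictly_log_concave_from 1 (\<lambda>n. root n (real ((4 * n) choose n)))"
    by (simp add: shifted_fuss_0 flip: numeral_2_eq_2)
  moreover have "strictly_log_concave_from 1 (\<lambda>n. root n (shifted_fuss 4 0 n))"
    by (rule base) (simp_all add: shifted_fuss_def fact_numeral)
  then have "strictly_log_concave_from 1 (\<lambda>n. root n (real ((5 * n) choose n)))"
    by (simp add: shifted_fuss_0 flip: numeral_2_eq_2)
  ultimately show ?thesis
    using strictly_log_concave_from_root_binomial_5_2 strictly_log_concave_from_root_fuss_catalan
    by blast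
qed

end
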